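(* Let $C_n$ denote the expected number of comparisons of 3-pivot Quicksort for a list of length $n$. Then for every integer $n\ge1$, $$C_{n+4}=\frac{(n+1)(12n+7)}{(n+4)(3n+1)}C_{n+3}-3\,\frac{(n+1)(6n+5)n}{(n+4)(n+3)(3n+1)}C_{n+2}$$ $$+\frac{12n^4+13n^3-12n^2+59n+24}{(3n+1)(n+4)(n+3)(n+2)}C_{n+1}-\frac{(3n+4)(n^2-5n+12)}{(n+4)(n+3)(3n+1)}C_n.$$
   Context: 3-pivot Quicksort on a list of $n\ge3$ distinct elements: three pivots are chosen uniformly at random and sorted by ordinary 1-pivot Quicksort (which for three elements takes 3 comparisons with probability $\frac23$ and 2 comparisons with probability $\frac13$); each of the $n-3$ other elements is placed into one of the four sublists determined by the pivots using exactly 2 comparisons (binary search); then the algorithm is applied recursively to the four sublists. Lists of length less than 3 are sorted by 1-pivot Quicksort. Formally, the probability generating function $P_n(t)$ of the total number of comparisons is determined by $P_0(t)=P_1(t)=1$, $P_2(t)=t$, $P_3(t)=\frac23t^3+\frac13t^2$ and, for $n\ge 4$, $$P_n(t)=\frac1{\binom n3}\sum_{k=3}^n\sum_{j=2}^{k-1}\sum_{i=1}^{j-1}P_{i-1}(t)P_{j-i-1}(t)P_{k-j-1}(t)P_{n-k}(t)\left(\tfrac23t^{2n-3}+\tfrac13t^{2n-4}\right),$$ and $C_n=P_n'(1)$. *)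

theory Defs
  imports Complex_Main "HOL-Computational_Algebra.Polynomial"
begin

text \<open>
  The probability generating function of the number of comparisons of 3-pivot Quicksort on a list
  of \<open>n\<close> distinct elements, as a polynomial in \<open>t\<close>.  Here \<open>i < j < k\<close> are the ranks of the three
  pivots.  The two monomials in the recursive case account for the \<open>2 (n - 3)\<close> comparisons of the
  partitioning step together with the 3 (probability \<open>2/3\<close>) or 2 (probability \<open>1/3\<close>) comparisons
  needed to sort the pivots.
\<close>

function qs3_pgf :: "nat \<Rightarrow> real poly" where
  "qs3_pgf n =
    (if n \<le> 1 then 1
     else if n = 2 then monom 1 1
     else if n = 3 then monom (2/3) 3 + monom (1/3) 2
     else smult (1 / real (n choose 3))
       (\<Sum>k = 3..n. \<Sum>j = 2..k-1. \<Sum>i = 1..j-1.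
          qs3_pgf (i - 1) * qs3_pgf (j - i - 1) * qs3_pgf (k - j - 1) * qs3_pgf (n - k)
            * (monom (2/3) (2*n - 3) + monom (1/3) (2*n - 4))))"
  by pat_completeness auto
termination
  by (relation "measure id") auto

declare qs3_pgf.simps [simp del]

definition qs3_expected :: "nat \<Rightarrow> real" where
  "qs3_expected n = poly (pderiv (qs3_pgf n)) 1"

end

theory Submission
  imports Defs "HOL-Computational_Algebra.Formal_Power_Series"
begin

text \<open>
  Differentiating the recursion for the generating functions at \<open>t = 1\<close>, where each of them has the
  value 1, gives a recurrence for the means \<open>C n\<close>:
  the quantity \<open>(n choose 3) * (C n - (2 * n - 10/3))\<close> is the sum, over all pivot ranks
  \<open>i < j < k\<close>, of the mean costs of the four sublists (\<open>expected_recurrence\<close>).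

  The rank differences range over all compositions of \<open>n - 3\<close> into four parts, so the sum is a
  fourfold convolution.  If \<open>C(X)\<close> is the generating function of the means, each of the
  four sublists contributes the \<open>n\<close>-th coefficient of \<open>X^3 * C(X) / (1 - X)^3\<close>.  Multiplying by
  \<open>(1 - X)^3\<close>, that is, taking third differences, removes the sum and leaves a linear
  recurrence of order 3 (\<open>expected_third_difference\<close>).  Its inhomogeneous part is the third
  difference of \<open>(n choose 3) * (2 * n - 10/3)\<close>, namely \<open>8/3 * (3 * n + 1)\<close>.  Therefore
  \<open>3 * n + 1\<close> times the instance at \<open>n + 1\<close> minus \<open>3 * n + 4\<close> times the instance at \<open>n\<close> is homogeneous,
  and solving it for \<open>C (n + 4)\<close> gives the theorem.
\<close>

unbundle fps_syntax

section \<open>Sums over pivot ranks as convolutions\<close>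

lemma fps_X_mult_convolution_nth:
  fixes F G :: "'a::comm_semiring_1 fps"
  shows "(fps_X * F * G) $ n = (\<Sum>k = 1..n. F $ (k - 1) * G $ (n - k))"
proof (cases n)
  case (Suc m)
  have "(\<Sum>k = 1..Suc m. F $ (k - 1) * G $ (Suc m - k)) = (\<Sum>k = 0..m. F $ k * G $ (m - k))"
    using sum.shift_bounds_cl_Suc_ivl[of "\<lambda>k. F $ (k - 1) * G $ (Suc m - k)" 0 m]
    by (simp del: sum.cl_ivl_Suc)
  also have "\<dots> = (fps_X * F * G) $ Suc m"
    by (simp add: mult.assoc fps_mult_nth[of F G] del: fps_mult_nth_0)
  finally show ?thesis
    using Suc by simp
qed (simp add: mult.assoc)

text \<open>
  Adding one pivot after another adds one factor of the product at a time.  The nested sums start at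
  2 and 3 rather than at 1, but the terms in between vanish, because the product for the pivots placed
  so far is a multiple of \<open>X\<close> or \<open>X^2\<close>.
\<close>

lemma sum_pivot_ranks_eq_fps_nth:
  fixes F1 F2 F3 F4 :: "'a::comm_semiring_1 fps"
  shows "(\<Sum>k = 3..n. \<Sum>j = 2..k-1. \<Sum>i = 1..j-1.
            F1 $ (i - 1) * F2 $ (j - i - 1) * F3 $ (k - j - 1) * F4 $ (n - k))
         = (fps_X ^ 3 * F1 * F2 * F3 * F4) $ n"
proof -
  let ?G2 = "fps_X * F1 * F2"
  let ?G3 = "fps_X * ?G2 * F3"
  have two: "(\<Sum>i = 1..j-1. F1 $ (i - 1) * F2 $ (j - i - 1)) = ?G2 $ (j - 1)" for j
    by (simp add: fps_X_mult_convolution_nth add.commute del: One_nat_def)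
  have three: "(\<Sum>j = 2..k-1. ?G2 $ (j - 1) * F3 $ (k - j - 1)) = ?G3 $ (k - 1)" for k
  proof -
    have "?G3 $ (k - 1) = (\<Sum>j = 1..k-1. ?G2 $ (j - 1) * F3 $ (k - j - 1))"
      by (simp only: fps_X_mult_convolution_nth[of ?G2] diff_commute[of k 1])
    also have "\<dots> = (\<Sum>j = 2..k-1. ?G2 $ (j - 1) * F3 $ (k - j - 1))"
      by (rule sum.mono_neutral_right) (auto simp: mult.assoc)
    finally show ?thesis ..
  qed
  have "(fps_X * ?G3 * F4) $ n = (\<Sum>k = 1..n. ?G3 $ (k - 1) * F4 $ (n - k))"
    by (rule fps_X_mult_convolution_nth)
  also have "\<dots> = (\<Sum>k = 3..n. ?G3 $ (k - 1) * F4 $ (n - k))"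
  proof (rule sum.mono_neutral_right)
    have "?G3 $ (k - 1) = 0" if "k < 3" for k
    proof -
      have "?G3 = fps_X ^ 2 * (F1 * F2 * F3)"
        by (simp add: power2_eq_square mult_ac)
      then show ?thesis using that by (simp only: fps_X_power_mult_nth) simp
    qed
    then show "\<forall>k \<in> {1..n} - {3..n}. ?G3 $ (k - 1) * F4 $ (n - k) = 0"
      by auto
  qed auto
  finally have "(fps_X * ?G3 * F4) $ n = (\<Sum>k = 3..n. ?G3 $ (k - 1) * F4 $ (n - k))" .
  then show ?thesis
    by (simp only: two[symmetric] three[symmetric] sum_distrib_right)
       (simp add: power3_eq_cube mult_ac)
qed

lemma sum_pivot_ranks_one:
  "(\<Sum>k = 3..n. \<Sum>j = 2..k-1. \<Sum>i = 1..j-1. 1::real) = real (n choose 3)"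
proof -
  have pairs: "(\<Sum>j = 2..m. real (j - 1)) = real (m choose 2)" for m
    by (induction m) (auto simp: numeral_2_eq_2 sum.atLeast_Suc_atMost)
  have triples: "(\<Sum>k = 3..m. real ((k - 1) choose 2)) = real (m choose 3)" for m
    by (induction m) (auto simp: numeral_3_eq_3 numeral_2_eq_2 binomial_eq_0)
  have singles: "(\<Sum>i = 1..m. 1) = real m" for m
    by simp
  show ?thesis
    by (simp only: singles pairs triples)
qed

section \<open>The recurrence for the means\<close>

lemma qs3_pgf_at_one: "poly (qs3_pgf n) 1 = 1"
proof (induction n rule: less_induct)
  case (less n)
  show ?case
  proof (cases "n \<le> 3")
    case True
    then show ?thesis
      by (subst qs3_pgf.simps) (auto simp: poly_monom)
  next
    case False
    have "poly (qs3_pgf n) 1 = 1 / real (n choose 3)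
        * (\<Sum>k = 3..n. \<Sum>j = 2..k-1. \<Sum>i = 1..j-1.
            poly (qs3_pgf (i - 1)) 1 * poly (qs3_pgf (j - i - 1)) 1 * poly (qs3_pgf (k - j - 1)) 1
              * poly (qs3_pgf (n - k)) 1)"
      using False by (subst qs3_pgf.simps) (simp add: poly_sum poly_monom)
    also have "\<dots> = 1 / real (n choose 3) * (\<Sum>k = 3..n. \<Sum>j = 2..k-1. \<Sum>i = 1..j-1. 1)"
      using False by (intro arg_cong2[where f = "(*)"] sum.cong refl) (auto simp: less.IH)
    finally show ?thesis using False
      by (simp only: sum_pivot_ranks_one) simp
  qed
qed

lemma poly_pderiv_mult_at_one:
  fixes p q :: "real poly"
  assumes "poly p 1 = 1" "poly q 1 = 1"
  shows "poly (pderiv (p * q)) 1 = poly (pderiv p) 1 + poly (pderiv q) 1"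
  using assms by (simp add: pderiv_mult)

lemma pderiv_sum: "pderiv (\<Sum>x\<in>A. f x) = (\<Sum>x\<in>A. pderiv (f x))"
  using higher_pderiv_sum[of 1 f A] by simp

lemma qs3_expected_small:
  "qs3_expected 0 = 0" "qs3_expected 3 = 8/3"
  by (simp_all add: qs3_expected_def qs3_pgf.simps pderiv_monom poly_monom pderiv_add)

text \<open>
  Multiplying by the binomial coefficient makes the recurrence hold for all lengths: for \<open>n < 3\<close> both
  sides are 0, and \<open>n = 3\<close> is consistent because the two partitioning monomials then
  reduce to the cost of sorting the pivots.
\<close>

lemma expected_recurrence:
  "real (n choose 3) * (qs3_expected n - (2 * real n - 10/3))
   = (\<Sum>k = 3..n. \<Sum>j = 2..k-1. \<Sum>i = 1..j-1.
        qs3_expected (i - 1) + qs3_expected (j - i - 1) + qs3_expected (k - j - 1)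
          + qs3_expected (n - k))"
proof -
  consider "n < 3" | "n = 3" | "n > 3" by linarith
  then show ?thesis
  proof cases
    case 1
    then show ?thesis by simp
  next
    case 2
    then show ?thesis by (simp add: qs3_expected_small)
  next
    case 3
    let ?m = "monom (2/3) (2*n - 3) + monom (1/3) (2*n - 4) :: real poly"
    let ?C = "\<lambda>i j k. qs3_expected (i - 1) + qs3_expected (j - i - 1) + qs3_expected (k - j - 1)
          + qs3_expected (n - k)"
    have m1: "poly ?m 1 = 1"
      by (simp add: poly_monom)
    have m': "poly (pderiv ?m) 1 = 2 * real n - 10/3"
      using 3 by (simp add: pderiv_add pderiv_monom poly_monom of_nat_diff field_simps)
    have summand: "poly (pderiv (qs3_pgf a * qs3_pgf b * qs3_pgf c * qs3_pgf d * ?m)) 1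
        = qs3_expected a + qs3_expected b + qs3_expected c + qs3_expected d + (2 * real n - 10/3)"
      for a b c d
      by (simp only: poly_pderiv_mult_at_one poly_mult qs3_pgf_at_one m1 m' qs3_expected_def
          mult_1_right)
    have pgf: "qs3_pgf n = smult (1 / real (n choose 3))
         (\<Sum>k = 3..n. \<Sum>j = 2..k-1. \<Sum>i = 1..j-1.
            qs3_pgf (i - 1) * qs3_pgf (j - i - 1) * qs3_pgf (k - j - 1) * qs3_pgf (n - k) * ?m)"
      using 3 by (subst qs3_pgf.simps) simp
    have "qs3_expected n = 1 / real (n choose 3)
        * (\<Sum>k = 3..n. \<Sum>j = 2..k-1. \<Sum>i = 1..j-1. ?C i j k + (2 * real n - 10/3))"
      unfolding qs3_expected_def[of n] pgf pderiv_smult pderiv_sum poly_smult poly_sum summand ..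
    also have "(\<Sum>k = 3..n. \<Sum>j = 2..k-1. \<Sum>i = 1..j-1. ?C i j k + (2 * real n - 10/3))
        = (\<Sum>k = 3..n. \<Sum>j = 2..k-1. \<Sum>i = 1..j-1. ?C i j k)
          + (2 * real n - 10/3) * (\<Sum>k = 3..n. \<Sum>j = 2..k-1. \<Sum>i = 1..j-1. 1)"
      by (simp only: sum.distrib sum_distrib_left mult_1_right)
    finally show ?thesis
      using 3 by (simp only: sum_pivot_ranks_one) (simp add: field_simps)
  qed
qed

section \<open>Eliminating the sums\<close>

lemma fps_one_minus_X_mult_nth_Suc:
  fixes F :: "'a::comm_ring_1 fps"
  shows "((1 - fps_X) * F) $ Suc n = F $ Suc n - F $ n"
  by (simp add: left_diff_distrib)

lemma expected_third_difference:
  defines "f \<equiv> \<lambda>n. real (n choose 3) * (qs3_expected n - (2 * real n - 10/3))"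
  shows "f (n + 3) - 3 * f (n + 2) + 3 * f (n + 1) - f n = 4 * qs3_expected n"
proof -
  let ?C = "Abs_fps qs3_expected" and ?E = "Abs_fps (\<lambda>_. 1 :: real)" and ?F = "Abs_fps f"
  let ?D = "1 - fps_X :: real fps"
  have geometric: "?D * ?E = 1"
    using fps_inverse_gp' by (simp add: fps_eq_iff left_diff_distrib)
  have "?F $ m = (4 * (fps_X ^ 3 * ?C * ?E ^ 3)) $ m" for m
  proof -
    have "?F $ m =
        (fps_X ^ 3 * ?C * ?E * ?E * ?E) $ m + (fps_X ^ 3 * ?E * ?C * ?E * ?E) $ m
        + (fps_X ^ 3 * ?E * ?E * ?C * ?E) $ m + (fps_X ^ 3 * ?E * ?E * ?E * ?C) $ m"
      unfolding sum_pivot_ranks_eq_fps_nth[symmetric]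
      by (simp add: f_def expected_recurrence sum.distrib del: sum_constant)
    also have "\<dots> = (4 * (fps_X ^ 3 * ?C * ?E ^ 3)) $ m"
      unfolding fps_add_nth[symmetric] by (rule arg_cong[where f = "\<lambda>G. G $ m"]) algebra
    finally show ?thesis .
  qed
  then have "?F = 4 * (fps_X ^ 3 * ?C * ?E ^ 3)"
    by (rule fps_ext)
  then have "?D * (?D * (?D * ?F)) = (?D * ?E) ^ 3 * (4 * (fps_X ^ 3 * ?C))"
    by algebra
  then have "?D * (?D * (?D * ?F)) = fps_const 4 * (fps_X ^ 3 * ?C)"
    by (simp add: geometric numeral_fps_const)
  then have "(?D * (?D * (?D * ?F))) $ (n + 3) = 4 * qs3_expected n"
    by (simp add: fps_X_power_mult_nth)
  moreover have "(?D * (?D * (?D * ?F))) $ (n + 3)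
      = f (n + 3) - 3 * f (n + 2) + 3 * f (n + 1) - f n"
    by (simp add: numeral_3_eq_3 numeral_2_eq_2 fps_one_minus_X_mult_nth_Suc)
  ultimately show ?thesis by simp
qed

lemma real_choose_three: "real (n choose 3) = real n * (real n - 1) * (real n - 2) / 6"
proof (induction n)
  case (Suc n)
  have "real (n choose 2) = real n * (real n - 1) / 2"
    by (induction n) (auto simp: numeral_2_eq_2 field_simps)
  with Suc show ?case
    by (simp add: numeral_3_eq_3 numeral_2_eq_2 field_simps)
qed simp

text \<open>
  The third difference is multiplied by 6 to clear the denominators of the binomial coefficients, so
  the four sublists contribute \<open>24 * C n\<close> and the tolls \<open>6 * 8/3 * (3 * n + 1)\<close>.
\<close>

lemma expected_linear_recurrence:
  "(real n + 3) * (real n + 2) * (real n + 1) * qs3_expected (n + 3)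
   - 3 * ((real n + 2) * (real n + 1) * real n) * qs3_expected (n + 2)
   + 3 * ((real n + 1) * real n * (real n - 1)) * qs3_expected (n + 1)
   - (real n * (real n - 1) * (real n - 2) + 24) * qs3_expected n
   = 16 * (3 * real n + 1)"
  using expected_third_difference[of n] unfolding real_choose_three by (simp add: field_simps)

theorem theorem4p23:
  fixes n :: nat
  assumes "n \<ge> 1"
  shows "qs3_expected (n + 4) =
      ((real n + 1) * (12 * real n + 7)) / ((real n + 4) * (3 * real n + 1))
        * qs3_expected (n + 3)
    - 3 * (((real n + 1) * (6 * real n + 5) * real n)
        / ((real n + 4) * (real n + 3) * (3 * real n + 1)))
        * qs3_expected (n + 2)
    + (12 * real n ^ 4 + 13 * real n ^ 3 - 12 * real n ^ 2 + 59 * real n + 24)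
        / ((3 * real n + 1) * (real n + 4) * (real n + 3) * (real n + 2))
        * qs3_expected (n + 1)
    - ((3 * real n + 4) * (real n ^ 2 - 5 * real n + 12))
        / ((real n + 4) * (real n + 3) * (3 * real n + 1))
        * qs3_expected n"
proof -
  define x where "x = real n"
  define c0 c1 c2 c3 c4 where
    "c0 = qs3_expected n" and "c1 = qs3_expected (n + 1)" and "c2 = qs3_expected (n + 2)"
    and "c3 = qs3_expected (n + 3)" and "c4 = qs3_expected (n + 4)"
  note c_defs = x_def c0_def c1_def c2_def c3_def c4_def
  have low: "(x + 3) * (x + 2) * (x + 1) * c3 - 3 * ((x + 2) * (x + 1) * x) * c2
      + 3 * ((x + 1) * x * (x - 1)) * c1 - (x * (x - 1) * (x - 2) + 24) * c0 = 16 * (3 * x + 1)"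
    unfolding c_defs by (rule expected_linear_recurrence)
  have high: "(x + 4) * (x + 3) * (x + 2) * c4 - 3 * ((x + 3) * (x + 2) * (x + 1)) * c3
      + 3 * ((x + 2) * (x + 1) * x) * c2 - ((x + 1) * x * (x - 1) + 24) * c1 = 16 * (3 * x + 4)"
    using expected_linear_recurrence[of "n + 1"] unfolding c_defs
    by (simp add: add_ac numeral_eq_Suc)
  \<comment> \<open>\<open>(3 * x + 1) * high - (3 * x + 4) * low\<close> cancels the right-hand sides.\<close>
  have eliminated: "(3 * x + 1) * (x + 4) * (x + 3) * (x + 2) * c4 =
      (x + 1) * (12 * x + 7) * (x + 3) * (x + 2) * c3
      - 3 * ((x + 1) * (6 * x + 5) * x) * (x + 2) * c2
      + (12 * x ^ 4 + 13 * x ^ 3 - 12 * x ^ 2 + 59 * x + 24) * c1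
      - (3 * x + 4) * (x ^ 2 - 5 * x + 12) * (x + 2) * c0"
    using low high by algebra
  have "3 * x + 1 \<noteq> 0" "x + 4 \<noteq> 0" "x + 3 \<noteq> 0" "x + 2 \<noteq> 0"
    by (simp_all add: x_def add_nonneg_eq_0_iff)
  then have "c4 = (x + 1) * (12 * x + 7) / ((x + 4) * (3 * x + 1)) * c3
      - 3 * (((x + 1) * (6 * x + 5) * x) / ((x + 4) * (x + 3) * (3 * x + 1))) * c2
      + (12 * x ^ 4 + 13 * x ^ 3 - 12 * x ^ 2 + 59 * x + 24)
          / ((3 * x + 1) * (x + 4) * (x + 3) * (x + 2)) * c1
      - ((3 * x + 4) * (x ^ 2 - 5 * x + 12)) / ((x + 4) * (x + 3) * (3 * x + 1)) * c0"
    using eliminated by (simp add: divide_simps) algebra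
  then show ?thesis unfolding c_defs .
qed

end
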